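(* Let $\mathcal{F}$ be the set of formulas built from a countably infinite set $P$ of propositional variables using $\neg$ (unary) and $\wedge,\vee$ (binary), and let $\mathrm{BD}=(\mathcal{F},\vdash)$ be Belnap-Dunn logic as described in the context. Then for all $A_1,A_2\in\mathcal{F}$: $A_1$ and $A_2$ are synonymous in $\mathrm{BD}$ if and only if $\nu(A_1)=\nu(A_2)$ for every valuation $\nu$ in the Belnap-Dunn matrix.
   Context: The Belnap-Dunn matrix is $M=(V,D,I)$ with $V=\{t,f,b,n\}$, designated values $D=\{t,b\}$, and, with $\le$ the partial order on $V$ having least element $f$, greatest element $t$, and $b,n$ incomparable: $I(\neg)$ swaps $t$ and $f$ and fixes $b$ and $n$; $I(\wedge)(a_1,a_2)=\inf\{a_1,a_2\}$; $I(\vee)(a_1,a_2)=\sup\{a_1,a_2\}$. A valuation is a map $\nu:\mathcal{F}\to V$ compatible with these operations (arbitrary on variables). For sets of formulas $\Gamma,\Delta$, $\Gamma\vdash\Delta$ iff every valuation that gives all formulas of $\Gamma$ a designated value gives some formula of $\Delta$ a designated value. Synonymity: $A_1$ and $A_2$ are synonymous in $\mathrm{BD}$ iff for all formulas $B_1,B_2$ such that $B_2$ is obtained from $B_1$ by replacing some or all occurrences of $A_1$ by $A_2$, both $\{B_1\}\vdash\{B_2\}$ and $\{B_2\}\vdash\{B_1\}$. *)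

theory Defs
  imports Main "HOL-Library.Countable_Set"
begin

datatype tv = TT | FF | BB | NN

text \<open>The two values \<open>BB\<close> and \<open>NN\<close> are incomparable, so their meet and join are the bounds
  \<open>FF\<close> and \<open>TT\<close>; the class instance certifies that \<^const>\<open>inf\<close> and \<^const>\<open>sup\<close> are the infimum and
  supremum for this order.\<close>

instantiation tv :: bounded_lattice
begin

definition less_eq_tv :: "tv \<Rightarrow> tv \<Rightarrow> bool" where
  "a \<le> b \<longleftrightarrow> a = b \<or> a = FF \<or> b = TT"

definition less_tv :: "tv \<Rightarrow> tv \<Rightarrow> bool" where
  "a < b \<longleftrightarrow> a \<le> b \<and> a \<noteq> (b :: tv)"

definition inf_tv :: "tv \<Rightarrow> tv \<Rightarrow> tv" where
  "inf a b = (if a \<le> b then a else if b \<le> a then b else FF)"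

definition sup_tv :: "tv \<Rightarrow> tv \<Rightarrow> tv" where
  "sup a b = (if a \<le> b then b else if b \<le> a then a else TT)"

definition bot_tv :: tv where "bot = FF"

definition top_tv :: tv where "top = TT"

instance
  by intro_classes
    (auto simp: less_eq_tv_def less_tv_def inf_tv_def sup_tv_def bot_tv_def top_tv_def)

end

fun tv_neg :: "tv \<Rightarrow> tv" where
  "tv_neg TT = FF"
| "tv_neg FF = TT"
| "tv_neg BB = BB"
| "tv_neg NN = NN"

definition designated :: "tv set" where
  "designated = {TT, BB}"

datatype 'p form =
    Var 'p
  | Neg "'p form"
  | Conj "'p form" "'p form"
  | Disj "'p form" "'p form"

definition valuation :: "('p form \<Rightarrow> tv) \<Rightarrow> bool" where
  "valuation \<nu> \<longleftrightarrow>
     (\<forall>A. \<nu> (Neg A) = tv_neg (\<nu> A)) \<and>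
     (\<forall>A B. \<nu> (Conj A B) = inf (\<nu> A) (\<nu> B)) \<and>
     (\<forall>A B. \<nu> (Disj A B) = sup (\<nu> A) (\<nu> B))"

definition entails :: "'p form set \<Rightarrow> 'p form set \<Rightarrow> bool" (infix \<open>\<turnstile>\<close> 50) where
  "\<Gamma> \<turnstile> \<Delta> \<longleftrightarrow>
     (\<forall>\<nu>. valuation \<nu> \<longrightarrow> (\<forall>A\<in>\<Gamma>. \<nu> A \<in> designated) \<longrightarrow> (\<exists>B\<in>\<Delta>. \<nu> B \<in> designated))"

text \<open>\<open>replaces A\<^sub>1 A\<^sub>2 B\<^sub>1 B\<^sub>2\<close>: \<open>B\<^sub>2\<close> arises from \<open>B\<^sub>1\<close> by replacing one or more occurrences of
  \<open>A\<^sub>1\<close>, not necessarily all of them, by \<open>A\<^sub>2\<close>. Distinct occurrences of \<open>A\<^sub>1\<close> in a formula never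
  overlap, so simultaneous replacement is well defined.\<close>

inductive replaces :: "'p form \<Rightarrow> 'p form \<Rightarrow> 'p form \<Rightarrow> 'p form \<Rightarrow> bool"
  for A\<^sub>1 A\<^sub>2 :: "'p form" where
  here: "replaces A\<^sub>1 A\<^sub>2 A\<^sub>1 A\<^sub>2"
| neg: "replaces A\<^sub>1 A\<^sub>2 B B' \<Longrightarrow> replaces A\<^sub>1 A\<^sub>2 (Neg B) (Neg B')"
| conj_left: "replaces A\<^sub>1 A\<^sub>2 B B' \<Longrightarrow> replaces A\<^sub>1 A\<^sub>2 (Conj B C) (Conj B' C)"
| conj_right: "replaces A\<^sub>1 A\<^sub>2 C C' \<Longrightarrow> replaces A\<^sub>1 A\<^sub>2 (Conj B C) (Conj B C')"
| conj_both: "replaces A\<^sub>1 A\<^sub>2 B B' \<Longrightarrow> replaces A\<^sub>1 A\<^sub>2 C C' \<Longrightarrow>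
    replaces A\<^sub>1 A\<^sub>2 (Conj B C) (Conj B' C')"
| disj_left: "replaces A\<^sub>1 A\<^sub>2 B B' \<Longrightarrow> replaces A\<^sub>1 A\<^sub>2 (Disj B C) (Disj B' C)"
| disj_right: "replaces A\<^sub>1 A\<^sub>2 C C' \<Longrightarrow> replaces A\<^sub>1 A\<^sub>2 (Disj B C) (Disj B C')"
| disj_both: "replaces A\<^sub>1 A\<^sub>2 B B' \<Longrightarrow> replaces A\<^sub>1 A\<^sub>2 C C' \<Longrightarrow>
    replaces A\<^sub>1 A\<^sub>2 (Disj B C) (Disj B' C')"

definition synonymous :: "'p form \<Rightarrow> 'p form \<Rightarrow> bool" where
  "synonymous A\<^sub>1 A\<^sub>2 \<longleftrightarrow>
     (\<forall>B\<^sub>1 B\<^sub>2. replaces A\<^sub>1 A\<^sub>2 B\<^sub>1 B\<^sub>2 \<longrightarrow> {B\<^sub>1} \<turnstile> {B\<^sub>2} \<and> {B\<^sub>2} \<turnstile> {B\<^sub>1})"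

end

theory Submission
  imports Defs
begin

text \<open>A truth value is determined by whether it and its negation are designated. Applying synonymity
  to the contexts \<open>A\<close> and \<open>\<not> A\<close> therefore already forces equal values; conversely, valuations are
  compositional, so replacing a formula by one with the same values preserves values.\<close>

text \<open>The pairs of answers for \<open>TT\<close>, \<open>FF\<close>, \<open>BB\<close>,
  \<open>NN\<close> are (yes, no), (no, yes), (yes, yes), (no, no), which are pairwise
  distinct.\<close>

lemma tv_eqI:
  assumes "a \<in> designated \<longleftrightarrow> b \<in> designated"
    and "tv_neg a \<in> designated \<longleftrightarrow> tv_neg b \<in> designated"
  shows "a = b"
  using assms by (cases a; cases b) (simp_all add: designated_def)

text \<open>Rule \<open>here\<close> is the assumed equality; every other rule follows since \<nu>
  commutes with the connectives.\<close>

lemma valuation_replaces: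
  assumes "replaces A\<^sub>1 A\<^sub>2 B\<^sub>1 B\<^sub>2" and "valuation \<nu>" and "\<nu> A\<^sub>1 = \<nu> A\<^sub>2"
  shows "\<nu> B\<^sub>1 = \<nu> B\<^sub>2"
  using assms by induction (simp_all add: valuation_def)

theorem theorem5:
  fixes A\<^sub>1 A\<^sub>2 :: "'p form"
  assumes "countable (UNIV :: 'p set)" and "infinite (UNIV :: 'p set)"
  shows "synonymous A\<^sub>1 A\<^sub>2 \<longleftrightarrow> (\<forall>\<nu>. valuation \<nu> \<longrightarrow> \<nu> A\<^sub>1 = \<nu> A\<^sub>2)"
proof
  assume syn: "synonymous A\<^sub>1 A\<^sub>2"
  have designated_iff: "\<nu> B\<^sub>1 \<in> designated \<longleftrightarrow> \<nu> B\<^sub>2 \<in> designated"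
    if "replaces A\<^sub>1 A\<^sub>2 B\<^sub>1 B\<^sub>2" "valuation \<nu>" for \<nu> B\<^sub>1 B\<^sub>2
    using syn that unfolding synonymous_def entails_def by blast
  show "\<forall>\<nu>. valuation \<nu> \<longrightarrow> \<nu> A\<^sub>1 = \<nu> A\<^sub>2"
  proof (intro allI impI)
    fix \<nu> :: "'p form \<Rightarrow> tv"
    assume \<nu>: "valuation \<nu>"
    show "\<nu> A\<^sub>1 = \<nu> A\<^sub>2"
    proof (rule tv_eqI)
      show "\<nu> A\<^sub>1 \<in> designated \<longleftrightarrow> \<nu> A\<^sub>2 \<in> designated"
        using designated_iff[OF replaces.here \<nu>] .
      \<comment> \<open>The context is negation: \<open>valuation_def\<close> turns the value of
        \<open>Neg\<close> into \<open>tv_neg\<close> of the value.\<close>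
      show "tv_neg (\<nu> A\<^sub>1) \<in> designated \<longleftrightarrow> tv_neg (\<nu> A\<^sub>2) \<in> designated"
        using designated_iff[OF replaces.neg[OF replaces.here] \<nu>] \<nu> by (simp add: valuation_def)
    qed
  qed
next
  assume "\<forall>\<nu>. valuation \<nu> \<longrightarrow> \<nu> A\<^sub>1 = \<nu> A\<^sub>2"
  then show "synonymous A\<^sub>1 A\<^sub>2"
    unfolding synonymous_def entails_def by (auto dest: valuation_replaces)
qed

end
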